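(* Let $X=\{a,b\}$. Let $u$ be a nonempty finite non-periodic word over $X$, let $W=u^\infty$, and suppose that $W$ has exactly $n$ finite forks. Then $|u|\le F(n+1)$.
   Context: A nonempty finite word $u$ is periodic if $u=v^m$ for some word $v$ and some $m\ge2$, and non-periodic otherwise; $|u|$ denotes its length. $W=u^\infty=\dots uuu\dots$ is the two-sided infinite periodic word with period $u$. A finite word $v$ (possibly empty) is a subword of $W$ if it occurs in $W$. A finite fork of $W$ is a finite word $v$ such that all four words $va$, $vb$, $av$, $bv$ are subwords of $W$. The Fibonacci numbers are defined by $F(0)=F(1)=1$ and $F(m+1)=F(m)+F(m-1)$. *)

theory Defs
  imports Complex_Main "HOL-Number_Theory.Fib"
begin

datatype letter = A | B

definition word_power :: "'a list \<Rightarrow> nat \<Rightarrow> 'a list" where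
  "word_power v m = concat (replicate m v)"

definition periodic_word :: "'a list \<Rightarrow> bool" where
  "periodic_word u \<longleftrightarrow> u \<noteq> [] \<and> (\<exists>v m. 2 \<le> m \<and> u = word_power v m)"

text \<open>
  Two-sided infinite words are functions on the integers. The word below is the periodic one whose
  positions \<open>0, \<dots>, |u| - 1\<close> carry \<open>u\<close>; it is meaningful only for nonempty \<open>u\<close>. Since the integer
  \<open>mod\<close> takes values in \<open>0, \<dots>, |u| - 1\<close> for negative positions as well, the copies of \<open>u\<close> extend
  in both directions.
\<close>

definition biinfinite_power :: "'a list \<Rightarrow> int \<Rightarrow> 'a" where
  "biinfinite_power u i = u ! nat (i mod int (length u))"

definition subword :: "'a list \<Rightarrow> (int \<Rightarrow> 'a) \<Rightarrow> bool" where
  "subword v W \<longleftrightarrow> (\<exists>k::int. \<forall>j<length v. v ! j = W (k + int j))"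

definition finite_fork :: "letter list \<Rightarrow> (int \<Rightarrow> letter) \<Rightarrow> bool" where
  "finite_fork v W \<longleftrightarrow>
     subword (v @ [A]) W \<and> subword (v @ [B]) W \<and> subword (A # v) W \<and> subword (B # v) W"

text \<open>
  The indexing \<open>F 0 = F 1 = 1\<close> is shifted by one against \<open>fib\<close>, for which \<open>fib 0 = 0\<close>, \<open>fib 1 = 1\<close>.
\<close>

definition F :: "nat \<Rightarrow> nat" where
  "F m = fib (m + 1)"

lemma F_0: "F 0 = 1" and F_1: "F 1 = 1"
  by (simp_all add: F_def)

lemma F_rec: "1 \<le> m \<Longrightarrow> F (m + 1) = F m + F (m - 1)"
  by (cases m) (simp_all add: F_def)

end

theory Submission
  imports Defs "HOL-Library.Sublist"
begin

text \<open>
  Finite forks are the bispecial words of \<open>W\<close>. A periodic word of least period \<open>p\<close> has exactly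
  \<open>p - 1\<close> right special words, and these are exactly the suffixes of the forks. A longest fork \<open>v\<close>
  occurs exactly twice in a period; cutting the period at these two places gives two periodic words
  \<open>g\<close> and \<open>h\<close> whose least periods add up to \<open>p\<close> and whose forks are forks of \<open>W\<close> other than \<open>v\<close>.
  If both had all the \<open>n - 1 > 0\<close> remaining forks, counting right special words would give \<open>g\<close> and
  \<open>h\<close> the same period \<open>q \<le> |v|\<close>, so that the letter after \<open>v\<close> would be the same in both, which
  it is not. Hence one of them has at most \<open>n - 2\<close> forks, and induction yields
  \<open>p \<le> F n + F (n - 1)\<close>.
\<close>

section \<open>Windows and least periods\<close>

definition window :: "(int \<Rightarrow> 'a) \<Rightarrow> int \<Rightarrow> nat \<Rightarrow> 'a list" where
  "window f i k = map (\<lambda>j. f (i + int j)) [0..<k]"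

lemma length_window [simp]: "length (window f i k) = k"
  by (simp add: window_def)

lemma window_0 [simp]: "window f i 0 = []"
  by (simp add: window_def)

lemma window_Suc: "window f i (Suc k) = window f i k @ [f (i + int k)]"
  by (simp add: window_def)

lemma window_Cons: "window f i (Suc k) = f i # window f (i + 1) k"
  by (rule nth_equalityI) (auto simp: window_def nth_Cons algebra_simps simp del: upt_Suc split: nat.split)

lemma window_add: "window f i (m + k) = window f i m @ window f (i + int m) k"
  by (induction k) (simp_all add: window_Suc algebra_simps)

lemma window_eq_iff:
  "window f i k = window g j k \<longleftrightarrow> (\<forall>t. 0 \<le> t \<and> t < int k \<longrightarrow> f (i + t) = g (j + t))"
proof
  assume "window f i k = window g j k"
  then have "f (i + int m) = g (j + int m)" if "m < k" for m
    using that by (simp add: window_def)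
  then show "\<forall>t. 0 \<le> t \<and> t < int k \<longrightarrow> f (i + t) = g (j + t)"
    by (metis nat_0_le zless_nat_conj of_nat_less_iff)
qed (simp add: window_def)

lemma window_shift: "window (\<lambda>i. f (c + i)) i k = window f (c + i) k"
  by (simp add: window_def add.assoc)

lemma subword_iff_window: "subword v f \<longleftrightarrow> (\<exists>i. v = window f i (length v))"
proof -
  have "v = window f i (length v) \<longleftrightarrow> (\<forall>j<length v. v ! j = f (i + int j))" for i
    unfolding list_eq_iff_nth_eq[of v] by (simp add: window_def)
  then show ?thesis unfolding subword_def by blast
qed

lemma subword_window [simp]: "subword (window f i k) f"
  unfolding subword_iff_window by (rule exI[of _ i]) simp

lemma subword_snoc_iff:
  "subword (v @ [x]) f \<longleftrightarrow> (\<exists>i. v = window f i (length v) \<and> x = f (i + int (length v)))"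
  unfolding subword_iff_window by (simp add: window_Suc)

lemma subword_appendD:
  assumes "subword (v @ w) f"
  shows "subword v f" "subword w f"
proof -
  obtain i where "v @ w = window f i (length v) @ window f (i + int (length v)) (length w)"
    using assms unfolding subword_iff_window by (auto simp: window_add)
  then have "v = window f i (length v)" "w = window f (i + int (length v)) (length w)"
    by (metis append_eq_append_conv length_window)+
  then show "subword v f" "subword w f" by (metis subword_window)+
qed

definition least_period :: "(int \<Rightarrow> 'a) \<Rightarrow> int \<Rightarrow> bool" where
  "least_period f p \<longleftrightarrow> 0 < p \<and> (\<forall>i. f (i + p) = f i) \<and>
     (\<forall>d. 0 < d \<and> (\<forall>i. f (i + d) = f i) \<longrightarrow> p \<le> d)"

lemma period_mult:
  fixes f :: "int \<Rightarrow> 'a"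
  assumes "\<And>i. f (i + p) = f i"
  shows "f (i + k * p) = f i"
proof (induction k rule: int_induct[where k = 0])
  case (step1 k)
  then show ?case using assms[of "i + k * p"] by (simp add: algebra_simps)
next
  case (step2 k)
  then show ?case using assms[of "i + (k - 1) * p"] by (simp add: algebra_simps)
qed simp

lemma period_mod:
  fixes f :: "int \<Rightarrow> 'a"
  assumes "\<And>i. f (i + p) = f i"
  shows "f (i mod p) = f i"
  using period_mult[of f p "i mod p" "i div p", OF assms] by simp

lemma window_period_mod:
  assumes "\<And>i. f (i + p) = f i"
  shows "window f (i mod p) k = window f i k"
proof -
  have "f (i mod p + t) = f (i + t)" for t
    using period_mod[of f p "i mod p + t", OF assms] period_mod[of f p "i + t", OF assms]
    by (simp add: mod_simps)
  then show ?thesis by (simp add: window_eq_iff)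
qed

text \<open>Otherwise \<open>d mod p\<close> would be a positive period below
  \<open>p\<close>.\<close>

lemma least_period_dvd:
  assumes "least_period f p" and d: "\<And>i. f (i + d) = f i"
  shows "p dvd d"
proof -
  have p: "0 < p" and per: "\<And>i. f (i + p) = f i"
    and least: "\<And>e. 0 < e \<Longrightarrow> (\<And>i. f (i + e) = f i) \<Longrightarrow> p \<le> e"
    using assms(1) by (auto simp: least_period_def)
  have "f (i + d mod p) = f i" for i
    using period_mod[of f p "i + d mod p", OF per] period_mod[of f p "i + d", OF per] d
    by (simp add: mod_simps)
  then have "\<not> 0 < d mod p"
    using least[of "d mod p"] pos_mod_bound[OF p, of d] by fastforce
  then show ?thesis using pos_mod_sign[OF p, of d] by (simp add: dvd_eq_mod_eq_0 del: pos_mod_sign)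
qed

lemma least_period_shift:
  assumes "least_period f p"
  shows "least_period (\<lambda>i. f (c + i)) p"
proof -
  have "\<forall>i. f (i + d) = f i" if "\<forall>i. f (c + (i + d)) = f (c + i)" for d
    using that by (metis add.assoc add.commute diff_add_cancel)
  then show ?thesis
    using assms unfolding least_period_def by (metis add.assoc)
qed

lemma subword_shift [simp]: "subword v (\<lambda>i. f (c + i)) \<longleftrightarrow> subword v f"
proof -
  have "(\<exists>i. v = window f (c + i) k) \<longleftrightarrow> (\<exists>i. v = window f i k)" for k
    by (metis add.commute diff_add_cancel)
  then show ?thesis by (simp add: subword_iff_window window_shift)
qed

lemma finite_fork_shift [simp]: "finite_fork v (\<lambda>i. f (c + i)) \<longleftrightarrow> finite_fork v f"
  by (simp add: finite_fork_def)

section \<open>Right special words\<close>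

definition right_special :: "letter list \<Rightarrow> (int \<Rightarrow> letter) \<Rightarrow> bool" where
  "right_special v f \<longleftrightarrow> subword (v @ [A]) f \<and> subword (v @ [B]) f"

lemma letter_neq: "x \<noteq> y \<Longrightarrow> z = x \<or> z = (y :: letter)"
  by (cases x; cases y; cases z) auto

text \<open>With only two letters, two different successors already exhaust the alphabet.\<close>

lemma right_specialI:
  assumes "window f i k = v" "window f j k = v" "f (i + int k) \<noteq> f (j + int k)"
  shows "right_special v f"
proof -
  have "subword (v @ [f (i + int k)]) f" "subword (v @ [f (j + int k)]) f"
    using assms by (metis subword_window window_Suc)+
  moreover have "x = f (i + int k) \<or> x = f (j + int k)" for x
    using letter_neq[OF assms(3)] by blast
  ultimately show ?thesis unfolding right_special_def by metis
qed

lemma right_specialE: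
  assumes "right_special v f"
  obtains i j where "window f i (length v) = v" "window f j (length v) = v"
    "f (i + int (length v)) = A" "f (j + int (length v)) = B"
  using assms unfolding right_special_def subword_snoc_iff by metis

lemma right_special_suffix:
  assumes "right_special (u @ v) f"
  shows "right_special v f"
  using assms subword_appendD(2)[of u "v @ [_]" f] by (auto simp: right_special_def)

lemma finite_fork_right_special: "finite_fork v f \<Longrightarrow> right_special v f"
  by (simp add: finite_fork_def right_special_def)

text \<open>Compare the letters preceding an occurrence of \<open>v\<close> followed by
  \<open>A\<close> and one followed by \<open>B\<close>: if they agree, they extend \<open>v\<close>
  to a longer right special word; if not, \<open>v\<close> is a fork.\<close>

lemma right_special_Cons_or_fork:
  assumes "right_special v f"
  shows "finite_fork v f \<or> (\<exists>x. right_special (x # v) f)"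
proof -
  obtain i j where ij: "window f i (length v) = v" "window f j (length v) = v"
    "f (i + int (length v)) = A" "f (j + int (length v)) = B"
    using right_specialE[OF assms] .
  have c: "window f (i - 1) (Suc (length v)) = f (i - 1) # v"
      "window f (j - 1) (Suc (length v)) = f (j - 1) # v"
    using ij by (simp_all add: window_Cons)
  show ?thesis
  proof (cases "f (i - 1) = f (j - 1)")
    case True
    have "right_special (f (i - 1) # v) f"
      using c True ij by (intro right_specialI[of f "i - 1" "Suc (length v)" _ "j - 1"]) auto
    then show ?thesis by blast
  next
    case False
    have "subword (f (i - 1) # v) f" "subword (f (j - 1) # v) f"
      using c by (metis subword_window)+
    then have "subword (x # v) f" for x
      using letter_neq[OF False, of x] by metis
    then show ?thesis using assms by (auto simp: finite_fork_def right_special_def)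
  qed
qed

text \<open>Without right special words of length \<open>m\<close>, a window of that length
  determines the next letter, hence everything to its right. By periodicity it then determines the
  whole word, so \<open>i - j\<close> is a period.\<close>

lemma window_eq_imp_dvd:
  assumes lp: "least_period f p"
    and det: "\<And>v. length v = m \<Longrightarrow> \<not> right_special v f"
    and eq: "window f i m = window f j m"
  shows "p dvd i - j"
proof -
  have p: "0 < p" and per: "\<And>i. f (i + p) = f i"
    using lp by (auto simp: least_period_def)
  have next_eq: "f (i + int m) = f (j + int m)" if "window f i m = window f j m" for i j
    using right_specialI[OF refl that[symmetric]] det[OF length_window] by blast
  have win: "window f (i + int t) m = window f (j + int t) m" for t
  proof (induction t)
    case (Suc t)
    have "window f (i + int t) (Suc m) = window f (j + int t) (Suc m)"
      unfolding window_Suc Suc next_eq[OF Suc] ..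
    then have "window f (i + int t + 1) m = window f (j + int t + 1) m"
      unfolding window_Cons by simp
    then show ?case by (simp add: add_ac)
  qed (simp add: eq)
  have nonneg: "f (i + t) = f (j + t)" if "int m \<le> t" for t
    using next_eq[OF win[of "nat (t - int m)"]] that by simp
  have all: "f (i + t) = f (j + t)" for t
  proof -
    \<comment> \<open>Moving by \<open>N\<close> periods brings any \<open>t\<close> to at least
      \<open>m\<close>, where agreement is already known.\<close>
    define N where "N = int m + \<bar>t\<bar>"
    have "N * 1 \<le> N * p" using p by (intro mult_left_mono) (auto simp: N_def)
    then have "f (i + (t + N * p)) = f (j + (t + N * p))"
      by (intro nonneg) (auto simp: N_def)
    then show ?thesis
      using period_mult[of f p "i + t" N, OF per] period_mult[of f p "j + t" N, OF per]
      by (simp add: add.assoc)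
  qed
  have "f (t + (i - j)) = f t" for t
    using all[of "t - j"] by (simp add: algebra_simps)
  then show ?thesis using least_period_dvd[OF lp] by blast
qed

section \<open>Subword complexity and the number of right special words\<close>

lemma range_window_period:
  assumes "least_period f p"
  shows "range (\<lambda>i. window f i k) = (\<lambda>i. window f i k) ` {0..<p}"
proof -
  have "window f i k \<in> (\<lambda>i. window f i k) ` {0..<p}" for i
    using assms window_period_mod[of f p i k] by (intro image_eqI[of _ _ "i mod p"])
      (auto simp: least_period_def)
  then show ?thesis by auto
qed

text \<open>A window of length \<open>k + 1\<close> is a window of length \<open>k\<close> with a
  letter that can follow it. Counting such pairs letter by letter counts exactly the right special
  words twice.\<close>

lemma card_range_window_Suc:
  assumes lp: "least_period f p"
  shows "card (range (\<lambda>i. window f i (Suc k))) =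
    card (range (\<lambda>i. window f i k)) + card {v. length v = k \<and> right_special v f}"
proof -
  define E where "E x = {v. length v = k \<and> subword (v @ [x]) f}" for x
  have un: "range (\<lambda>i. window f i k) = E A \<union> E B"
  proof -
    have "window f i k \<in> E (f (i + int k))" for i
      by (auto simp: E_def subword_snoc_iff)
    moreover have "E x \<subseteq> E A \<union> E B" "E x \<subseteq> range (\<lambda>i. window f i k)" for x
      by (cases x, auto) (auto simp: E_def subword_snoc_iff)
    ultimately show ?thesis by blast
  qed
  have "finite (range (\<lambda>i. window f i k))"
    using range_window_period[OF lp] by simp
  then have fin: "finite (E A)" "finite (E B)" using un by auto
  have "range (\<lambda>i. window f i (Suc k)) = (\<lambda>v. v @ [A]) ` E A \<union> (\<lambda>v. v @ [B]) ` E B"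
  proof (intro equalityI subsetI)
    fix w assume "w \<in> range (\<lambda>i. window f i (Suc k))"
    then obtain i where w: "w = window f i k @ [f (i + int k)]"
      by (auto simp: window_Suc)
    then have "window f i k \<in> E (f (i + int k))" by (auto simp: E_def subword_snoc_iff)
    then show "w \<in> (\<lambda>v. v @ [A]) ` E A \<union> (\<lambda>v. v @ [B]) ` E B"
      unfolding w by (cases "f (i + int k)") auto
  next
    fix w assume "w \<in> (\<lambda>v. v @ [A]) ` E A \<union> (\<lambda>v. v @ [B]) ` E B"
    then show "w \<in> range (\<lambda>i. window f i (Suc k))"
      by (auto simp: E_def subword_iff_window)
  qed
  moreover have "card ((\<lambda>v. v @ [A]) ` E A \<union> (\<lambda>v. v @ [B]) ` E B) =
      card ((\<lambda>v. v @ [A]) ` E A) + card ((\<lambda>v. v @ [B]) ` E B)"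
    using fin by (intro card_Un_disjoint) auto
  ultimately have "card (range (\<lambda>i. window f i (Suc k))) = card (E A) + card (E B)"
    by (simp add: card_image inj_on_def)
  also have "\<dots> = card (E A \<union> E B) + card (E A \<inter> E B)"
    using card_Un_Int[OF fin] .
  also have "E A \<inter> E B = {v. length v = k \<and> right_special v f}"
    by (auto simp: E_def right_special_def)
  finally show ?thesis using un by simp
qed

lemma card_range_window:
  assumes "least_period f p"
  shows "card (range (\<lambda>i. window f i K)) =
    1 + (\<Sum>k<K. card {v. length v = k \<and> right_special v f})"
  by (induction K) (simp_all add: card_range_window_Suc[OF assms])

lemma finite_lists_length_letter: "finite {v :: letter list. length v = k \<and> P v}"
proof -
  have "(UNIV :: letter set) = {A, B}" using letter.exhaust by blast
  then have "finite (UNIV :: letter set)" by (metis finite.emptyI finite_insert)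
  then have "finite {v :: letter list. set v \<subseteq> UNIV \<and> length v = k}"
    by (rule finite_lists_length_eq)
  then show ?thesis by (rule rev_finite_subset) auto
qed

text \<open>All suffixes of \<open>v\<close> are right special too, so the number of windows grows
  at every length up to that of \<open>v\<close>; but there are never more than \<open>p\<close>
  windows of a given length.\<close>

lemma right_special_length_less:
  assumes lp: "least_period f p" and "right_special v f"
  shows "length v < nat p"
proof -
  let ?r = "\<lambda>k. card {v. length v = k \<and> right_special v f}"
  have "1 \<le> ?r k" if "k \<le> length v" for k
  proof -
    have "right_special (drop (length v - k) v) f"
      using assms(2) right_special_suffix[of "take (length v - k) v" "drop (length v - k) v"] by simp
    then have "{v. length v = k \<and> right_special v f} \<noteq> {}"
      using that by (auto intro!: exI[of _ "drop (length v - k) v"])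
    then show ?thesis
      using finite_lists_length_letter[of k "\<lambda>v. right_special v f"] by (simp add: Suc_le_eq card_gt_0_iff)
  qed
  then have "(\<Sum>k<Suc (length v). 1) \<le> (\<Sum>k<Suc (length v). ?r k)"
    by (intro sum_mono) auto
  then have "Suc (length v) < card (range (\<lambda>i. window f i (Suc (length v))))"
    using card_range_window[OF lp, of "Suc (length v)"] by simp
  also have "\<dots> \<le> nat p"
    using card_image_le[of "{0..<p}" "\<lambda>i. window f i (Suc (length v))"]
    by (simp add: range_window_period[OF lp])
  finally show ?thesis by simp
qed

lemma finite_right_special:
  assumes "least_period f p"
  shows "finite {v. right_special v f}"
proof (rule finite_subset)
  show "{v. right_special v f} \<subseteq> (\<Union>k<nat p. {v. length v = k \<and> right_special v f})"
    using right_special_length_less[OF assms] by auto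
qed (auto intro: finite_lists_length_letter)

text \<open>No right special word has length \<open>p\<close>, so windows of length \<open>p\<close>
  determine their position modulo \<open>p\<close> and there are exactly \<open>p\<close> of them.
  Summing the increments of the complexity from length 0 gives the count.\<close>

lemma least_period_eq_card:
  assumes lp: "least_period f p"
  shows "nat p = 1 + card {v. right_special v f}"
proof -
  have "inj_on (\<lambda>i. window f i (nat p)) {0..<p}"
  proof (rule inj_onI)
    fix i j assume ij: "i \<in> {0..<p}" "j \<in> {0..<p}" "window f i (nat p) = window f j (nat p)"
    have "\<not> right_special v f" if "length v = nat p" for v
      using right_special_length_less[OF lp, of v] that by auto
    then have "p dvd i - j" using window_eq_imp_dvd[OF lp _ ij(3)] by blast
    then have "i mod p = j mod p" by (simp add: mod_eq_dvd_iff)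
    then show "i = j" using ij(1,2) by simp
  qed
  then have "nat p = card (range (\<lambda>i. window f i (nat p)))"
    by (simp add: range_window_period[OF lp] card_image)
  also have "\<dots> = 1 + (\<Sum>k<nat p. card {v. length v = k \<and> right_special v f})"
    by (rule card_range_window[OF lp])
  also have "(\<Sum>k<nat p. card {v. length v = k \<and> right_special v f}) =
      card (\<Union>k<nat p. {v. length v = k \<and> right_special v f})"
    by (rule card_UN_disjoint[symmetric]) (auto intro: finite_lists_length_letter)
  also have "(\<Union>k<nat p. {v. length v = k \<and> right_special v f}) = {v. right_special v f}"
    using right_special_length_less[OF lp] by auto
  finally show ?thesis .
qed

text \<open>A right special word that is no fork extends to the left as a right special word; the
  length bound \<open>p\<close> stops this, and it can stop only at a fork.\<close>

lemma right_special_iff_suffix_fork: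
  assumes lp: "least_period f p"
  shows "right_special v f \<longleftrightarrow> (\<exists>w. finite_fork w f \<and> suffix v w)"
proof
  assume "right_special v f"
  then show "\<exists>w. finite_fork w f \<and> suffix v w"
  proof (induction "nat p - length v" arbitrary: v rule: less_induct)
    case less
    show ?case
    proof (cases "finite_fork v f")
      case False
      then obtain x where x: "right_special (x # v) f"
        using right_special_Cons_or_fork[OF less.prems] by blast
      have "nat p - length (x # v) < nat p - length v"
        using right_special_length_less[OF lp x] by simp
      from less.hyps[OF this x] show ?thesis
        by (meson suffix_ConsD)
    qed blast
  qed
next
  assume "\<exists>w. finite_fork w f \<and> suffix v w"
  then show "right_special v f"
    using finite_fork_right_special right_special_suffix unfolding suffix_def by blast
qed

lemma finite_forks: "least_period f p \<Longrightarrow> finite {v. finite_fork v f}"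
  by (rule finite_subset[OF _ finite_right_special]) (auto dest: finite_fork_right_special)

section \<open>Cutting the period at a longest fork\<close>

text \<open>One arc of the period, shifted to start at 0: \<open>q\<close> is the first return of
  \<open>v\<close> after its occurrence at 0. No right special word of \<open>f\<close> is longer
  than \<open>v\<close>.\<close>

locale cut =
  fixes f :: "int \<Rightarrow> letter" and p q :: int and v :: "letter list" and k :: nat
  assumes lp: "least_period f p"
    and longest: "\<And>w. right_special w f \<Longrightarrow> length w \<le> k"
    and v_0: "window f 0 k = v"
    and v_q: "window f q k = v"
    and q_pos: "0 < q"
    and v_only: "\<And>i. 0 \<le> i \<Longrightarrow> i < q \<Longrightarrow> window f i k = v \<Longrightarrow> i = 0"
begin

text \<open>The arc, that is the return word of \<open>v\<close> at 0, repeated in both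
  directions.\<close>

definition g :: "int \<Rightarrow> letter" where
  "g i = f (i mod q)"

lemma length_v: "length v = k"
  using v_0 by auto

lemma g_period: "g (i + q) = g i"
  by (simp add: g_def)

text \<open>
  As \<open>v\<close> stands in \<open>f\<close> both at \<open>0\<close> and at \<open>q\<close>, the agreement extends past \<open>q\<close> by the length of \<open>v\<close>;
  this is why words of \<open>g\<close> of length up to \<open>k + 1\<close> already occur in \<open>f\<close>.
\<close>

lemma g_eq: "0 \<le> t \<Longrightarrow> t < q + int k \<Longrightarrow> g t = f t"
proof (induction "nat t" arbitrary: t rule: less_induct)
  case less
  show ?case
  proof (cases "t < q")
    case False
    then have "g (t - q) = f (t - q)"
      using less q_pos by (intro less.hyps) auto
    moreover have "f (q + (t - q)) = f (0 + (t - q))"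
      using v_0 v_q False less.prems window_eq_iff[of f q k f 0]
      by (metis add_diff_cancel_left' diff_ge_0_iff_ge diff_less_eq add.commute linorder_not_less)
    ultimately show ?thesis using g_period[of "t - q"] by simp
  qed (use less.prems in \<open>simp add: g_def\<close>)
qed

lemma window_g: "0 \<le> i \<Longrightarrow> i + int m \<le> q + int k \<Longrightarrow> window g i m = window f i m"
  by (auto simp: window_eq_iff intro!: g_eq)

lemma subword_g:
  assumes "subword w g"
  obtains i where "0 \<le> i" "i < q" "w = window g i (length w)"
  using assms window_period_mod[of g q, OF g_period] q_pos
  unfolding subword_iff_window by (metis pos_mod_bound pos_mod_sign)

lemma subword_g_imp_f:
  assumes "subword w g" "length w \<le> Suc k"
  shows "subword w f"
proof -
  obtain i where i: "0 \<le> i" "i < q" "w = window g i (length w)"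
    using subword_g[OF assms(1)] .
  then have "window g i (length w) = window f i (length w)"
    using assms(2) by (intro window_g) auto
  then show ?thesis using i(3) by (metis subword_window)
qed

lemma v_only_g:
  assumes "window g i k = v"
  shows "q dvd i"
proof -
  have m: "0 \<le> i mod q" "i mod q < q" using q_pos by auto
  have "window f (i mod q) k = window g (i mod q) k"
    using m by (intro window_g[symmetric]) auto
  also have "\<dots> = window g i k" by (rule window_period_mod[of g q, OF g_period])
  also have "\<dots> = v" by (rule assms)
  finally have "window f (i mod q) k = v" .
  then have "i mod q = 0" using v_only m by blast
  then show ?thesis by (rule mod_0_imp_dvd)
qed

text \<open>A period \<open>d\<close> carries the occurrence of \<open>v\<close> at 0 to
  \<open>d\<close>, and \<open>v\<close> occurs in \<open>g\<close> only at multiples of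
  \<open>q\<close>.\<close>

lemma least_period_g: "least_period g q"
  unfolding least_period_def
proof (intro conjI allI impI)
  fix d assume d: "0 < d \<and> (\<forall>i. g (i + d) = g i)"
  have "window g d k = window g 0 k"
    using d by (auto simp: window_eq_iff add.commute)
  also have "\<dots> = v" using window_g[of 0 k] q_pos v_0 by simp
  finally show "q \<le> d" using v_only_g d zdvd_imp_le by blast
qed (auto simp: q_pos g_period)

text \<open>All occurrences of \<open>v\<close> in \<open>g\<close> are congruent modulo
  \<open>q\<close>, so the same letter follows each.\<close>

lemma v_not_right_special_g: "\<not> right_special v g"
proof
  assume "right_special v g"
  then obtain i j where "window g i k = v" "window g j k = v" "g (i + int k) = A" "g (j + int k) = B"
    using right_specialE length_v by metis
  moreover from this have "i mod q = j mod q" using v_only_g by (simp add: dvd_eq_mod_eq_0)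
  then have "g (i + int k) = g (j + int k)"
    unfolding g_def by (metis mod_add_left_eq)
  ultimately show False by simp
qed

text \<open>A right special word of \<open>g\<close> that is too long has a right special suffix
  \<open>z\<close> of length \<open>k + 1\<close>. Its extensions have length \<open>k + 2\<close>,
  one more than what passes to \<open>f\<close> from every start; the exceptional start has to be
  excluded.\<close>

lemma right_special_g_length:
  assumes "right_special w g"
  shows "length w \<le> k"
proof (rule ccontr)
  assume "\<not> length w \<le> k"
  define z where "z = drop (length w - Suc k) w"
  have len: "length z = Suc k" using \<open>\<not> length w \<le> k\<close> by (simp add: z_def)
  have "right_special z g"
    using assms right_special_suffix[of "take (length w - Suc k) w" z] by (simp add: z_def)
  then have "subword (z @ [A]) g" "subword (z @ [B]) g" by (auto simp: right_special_def)
  then obtain i j where i: "0 \<le> i" "i < q" "z @ [A] = window g i (Suc (Suc k))"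
    and j: "0 \<le> j" "j < q" "z @ [B] = window g j (Suc (Suc k))"
    using subword_g len by (metis length_append_singleton)
  \<comment> \<open>Only from the start \<open>q - 1\<close> do \<open>k + 2\<close> letters leave
    the range where \<open>g\<close> agrees with \<open>f\<close>. Whether this happens depends on
    \<open>z\<close> alone, so it happens for both extensions or for neither; as their starts
    differ, for neither.\<close>
  have last_iff: "i' = q - 1 \<longleftrightarrow> tl z = v"
    if i': "0 \<le> i'" "i' < q" "z @ [x] = window g i' (Suc (Suc k))" for i' x
  proof -
    have "z = window g i' (Suc k)" using i'(3) by (simp add: window_Suc)
    then have tl: "tl z = window g (i' + 1) k" by (simp add: window_Cons)
    show ?thesis
    proof
      assume "i' = q - 1"
      then show "tl z = v" using tl window_g[of q k] q_pos v_q by simp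
    next
      assume "tl z = v"
      then have "q dvd i' + 1" using v_only_g tl by metis
      then show "i' = q - 1" using i' zdvd_imp_le[of q "i' + 1"] by auto
    qed
  qed
  have "i \<noteq> j" using i j by (metis last_snoc letter.distinct(1))
  then have "i \<noteq> q - 1" "j \<noteq> q - 1" using last_iff[OF i] last_iff[OF j] by auto
  then have "z @ [A] = window f i (Suc (Suc k))" "z @ [B] = window f j (Suc (Suc k))"
    using i j window_g[of i "Suc (Suc k)"] window_g[of j "Suc (Suc k)"] by auto
  then have "right_special z f"
    unfolding right_special_def by (metis subword_window)
  then show False using longest[of z] len by simp
qed

text \<open>Forks of \<open>g\<close> have length at most \<open>k\<close>, so their one-letter
  extensions are short enough to occur in \<open>f\<close>.\<close>

lemma forks_g: "{w. finite_fork w g} \<subseteq> {w. finite_fork w f} - {v}"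
proof
  fix w assume w: "w \<in> {w. finite_fork w g}"
  then have rs: "right_special w g" by (simp add: finite_fork_right_special)
  have "finite_fork w f"
    using w right_special_g_length[OF rs] by (auto simp: finite_fork_def intro!: subword_g_imp_f)
  then show "w \<in> {w. finite_fork w f} - {v}" using rs v_not_right_special_g by auto
qed

end

text \<open>Extended by its next letter, the word exceeds every right special word and so fixes its
  position modulo \<open>p\<close>; only two letters can follow.\<close>

lemma longest_fork_two_occurrences:
  assumes lp: "least_period f p"
    and longest: "\<And>w. right_special w f \<Longrightarrow> length w \<le> k"
    and "window f i k = window f j k" "window f i' k = window f i k"
    and "f (i + int k) \<noteq> f (j + int k)"
  shows "p dvd i' - i \<or> p dvd i' - j"
proof -
  have det: "\<not> right_special w f" if "length w = Suc k" for w
    using longest[of w] that by auto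
  have "f (i' + int k) = f (i + int k) \<or> f (i' + int k) = f (j + int k)"
    using letter_neq[OF assms(5)] by blast
  then have "window f i' (Suc k) = window f i (Suc k) \<or> window f i' (Suc k) = window f j (Suc k)"
    using assms(3,4) by (auto simp: window_Suc)
  then show ?thesis using window_eq_imp_dvd[OF lp det] by blast
qed

text \<open>Modulo \<open>p\<close>, \<open>v\<close> occurs once followed by \<open>A\<close> and
  once followed by \<open>B\<close>. These places split the period into two arcs meeting
  \<open>v\<close> only at their ends; the inequality records that different letters follow
  \<open>v\<close> at the two starts.\<close>

lemma cut_exists:
  assumes lp: "least_period f p"
    and longest: "\<And>w. right_special w f \<Longrightarrow> length w \<le> length v"
    and rs: "right_special v f"
  obtains c q where "cut (\<lambda>i. f (c + i)) p q v (length v)"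
    "cut (\<lambda>i. f (c + q + i)) p (p - q) v (length v)"
    "f (c + int (length v)) \<noteq> f (c + q + int (length v))"
proof -
  define k where "k = length v"
  have p: "0 < p" and per: "\<And>i. f (i + p) = f i"
    using lp by (auto simp: least_period_def)
  obtain i j where ij: "window f i k = v" "window f j k = v" "f (i + int k) = A" "f (j + int k) = B"
    using right_specialE[OF rs] unfolding k_def .
  define q where "q = (j - i) mod p"
  have iq: "(i + q) mod p = j mod p" by (simp add: q_def mod_simps)
  have win_iq: "window f (i + q) k = v"
    using ij(2) window_period_mod[of f p "i + q" k, OF per] window_period_mod[of f p j k, OF per] iq
    by simp
  have f_iq: "f (i + q + int k) = B"
    using ij(4) period_mod[of f p "i + q + int k", OF per] period_mod[of f p "j + int k", OF per] iq
    by (metis mod_add_left_eq)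
  have q: "0 < q" "q < p"
  proof -
    have "q \<noteq> 0" using f_iq ij(3) by auto
    then show "0 < q" "q < p"
      using pos_mod_sign[OF p, of "j - i"] pos_mod_bound[OF p, of "j - i"] unfolding q_def by linarith+
  qed
  have two: "p dvd m - i \<or> p dvd m - (i + q)" if "window f m k = v" for m
    using that ij(1,3) win_iq f_iq longest
    by (intro longest_fork_two_occurrences[OF lp, where k = k]) (auto simp: k_def)
  have no_dvd: "\<not> p dvd d" if "0 < d" "d < p" for d
    using that zdvd_imp_le by fastforce
  have "cut (\<lambda>t. f (i + t)) p q v k"
  proof
    fix t assume t: "0 \<le> t" "t < q" "window (\<lambda>t. f (i + t)) t k = v"
    then have "p dvd t \<or> p dvd q - t"
      using two[of "i + t"] by (auto simp: window_shift dvd_diff_commute)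
    then show "t = 0" using no_dvd[of t] no_dvd[of "q - t"] t(1,2) q by linarith
  qed (use lp ij win_iq longest q in \<open>auto simp: window_shift k_def right_special_def
        intro: least_period_shift\<close>)
  moreover have "cut (\<lambda>t. f (i + q + t)) p (p - q) v k"
  proof
    fix t assume t: "0 \<le> t" "t < p - q" "window (\<lambda>t. f (i + q + t)) t k = v"
    have "i + q + t - i = q + t" "i + q + t - (i + q) = t" by simp_all
    then have "p dvd q + t \<or> p dvd t"
      using two[OF t(3)[unfolded window_shift]] by metis
    then show "t = 0" using no_dvd[of t] no_dvd[of "q + t"] t(1,2) q by linarith
  next
    \<comment> \<open>The second arc ends at the first occurrence of \<open>v\<close>, one period
      later.\<close>
    have "window f (i + p) k = window f i k"
      using window_period_mod[of f p "i + p" k, OF per] window_period_mod[of f p i k, OF per] by simp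
    then show "window (\<lambda>t. f (i + q + t)) (p - q) k = v"
      using ij(1) by (simp add: window_shift)
  qed (use lp ij win_iq longest q in \<open>auto simp: window_shift k_def right_special_def
        intro: least_period_shift\<close>)
  ultimately show ?thesis
    using that[of i q] f_iq ij(3) by (simp add: k_def)
qed

section \<open>The Fibonacci bound by induction on the number of forks\<close>

lemma F_mono: "m \<le> n \<Longrightarrow> F m \<le> F n"
  by (simp add: F_def fib_mono)

theorem least_period_le_F:
  assumes "least_period f p" and "card {v. finite_fork v f} = n"
  shows "nat p \<le> F (n + 1)"
  using assms
proof (induction n arbitrary: f p rule: less_induct)
  case (less n)
  note lp = less.prems(1)
  let ?\<Phi> = "{v. finite_fork v f}"
  have fin: "finite ?\<Phi>" by (rule finite_forks[OF lp])
  show ?case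
  proof (cases "?\<Phi> = {}")
    case True
    then have "{v. right_special v f} = {}" using right_special_iff_suffix_fork[OF lp] by blast
    then show ?thesis
      \<comment> \<open>Without right special words the period is 1.\<close>
      using least_period_eq_card[OF lp] F_mono[of 0 "n + 1"] by (simp add: F_0)
  next
    case False
    then have "Max (length ` ?\<Phi>) \<in> length ` ?\<Phi>" using fin by (intro Max_in) auto
    then obtain v where v: "finite_fork v f" and "length v = Max (length ` ?\<Phi>)" by auto
    then have "length w \<le> length v" if "finite_fork w f" for w
      using fin that by simp
    then have longest: "length w \<le> length v" if "right_special w f" for w
      using that right_special_iff_suffix_fork[OF lp] suffix_length_le le_trans by blast
    obtain c q where cut1: "cut (\<lambda>i. f (c + i)) p q v (length v)"
      and cut2: "cut (\<lambda>i. f (c + q + i)) p (p - q) v (length v)"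
      and differ: "f (c + int (length v)) \<noteq> f (c + q + int (length v))"
      using cut_exists[OF lp longest finite_fork_right_special[OF v]] by blast
    interpret g: cut "\<lambda>i. f (c + i)" p q v "length v" by (rule cut1)
    interpret h: cut "\<lambda>i. f (c + q + i)" p "p - q" v "length v" by (rule cut2)
    let ?G = "{w. finite_fork w g.g}" and ?H = "{w. finite_fork w h.g}"
    have sub: "?G \<subseteq> ?\<Phi> - {v}" "?H \<subseteq> ?\<Phi> - {v}"
      using g.forks_g h.forks_g by simp_all
    have fin': "finite ?G" "finite ?H" using sub fin finite_subset by blast+
    have n: "card (?\<Phi> - {v}) = n - 1" "0 < n"
      using less.prems(2) v fin card_gt_0_iff by auto
    have small: "card ?G \<le> n - 1" "card ?H \<le> n - 1"
      using sub card_mono[OF finite_Diff[OF fin], of _ "{v}"] n by metis+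
    have p_eq: "nat p = nat q + nat (p - q)" using g.q_pos h.q_pos by simp
    have IH: "nat q \<le> F (card ?G + 1)" "nat (p - q) \<le> F (card ?H + 1)"
      using small n(2) by (intro less.IH[OF _ _ refl] g.least_period_g h.least_period_g; simp)+
    show ?thesis
    \<comment> \<open>If \<open>v\<close> is the only fork, both arcs are without forks and the
      exclusion below has no remaining fork to work with; but then both periods are at most 1, and
      \<open>F 2 = 2\<close>.\<close>
    proof (cases "n = 1")
      case True
      then have "F (card ?G + 1) = 1" "F (card ?H + 1) = 1" using small by (simp_all add: F_def)
      then have "nat p \<le> 2" using IH p_eq by simp
      then show ?thesis using True by (simp add: F_def numeral_eq_Suc)
    next
      case False
      have "\<not> (card ?G = n - 1 \<and> card ?H = n - 1)"
      proof
        assume "card ?G = n - 1 \<and> card ?H = n - 1"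
        then have eq: "?G = ?\<Phi> - {v}" "?H = ?\<Phi> - {v}"
          using sub n(1) fin card_subset_eq[of "?\<Phi> - {v}"] by auto
        let ?R = "\<lambda>f. {w. right_special w f}"
        have R_iff: "right_special w g.g \<longleftrightarrow> (\<exists>x. x \<in> ?\<Phi> - {v} \<and> suffix w x)"
          "right_special w h.g \<longleftrightarrow> (\<exists>x. x \<in> ?\<Phi> - {v} \<and> suffix w x)" for w
          using right_special_iff_suffix_fork[OF g.least_period_g]
            right_special_iff_suffix_fork[OF h.least_period_g] eq by blast+
        \<comment> \<open>Equal forks give equal right special words, and their number determines
          the period.\<close>
        have q_eq: "p - q = q"
          using least_period_eq_card[OF g.least_period_g] least_period_eq_card[OF h.least_period_g]
            R_iff g.q_pos h.q_pos by simp
        have "card (?\<Phi> - {v}) \<noteq> 0" using False n by simp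
        then have "?\<Phi> - {v} \<noteq> {}" by (metis card.empty)
        \<comment> \<open>The empty suffix of \<open>v\<close> is thus already counted for
          \<open>g\<close>, so \<open>v\<close> contributes at most \<open>length v\<close> further
          right special words. Counting one more would only give
          \<open>q \<le> length v + 1\<close>.\<close>
        then have nil: "right_special [] g.g" using R_iff by auto
        have "?R f \<subseteq> ?R g.g \<union> (set (suffixes v) - {[]})"
        proof
          fix w assume "w \<in> ?R f"
          then obtain x where "finite_fork x f" "suffix w x"
            using right_special_iff_suffix_fork[OF lp] by blast
          then show "w \<in> ?R g.g \<union> (set (suffixes v) - {[]})"
            using nil R_iff by (cases "x = v"; cases "w = []") auto
        qed
        then have "card (?R f) \<le> card (?R g.g \<union> (set (suffixes v) - {[]}))"
          by (intro card_mono) (auto intro: finite_right_special[OF g.least_period_g])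
        also have "\<dots> \<le> card (?R g.g) + card (set (suffixes v) - {[]})"
          by (rule card_Un_le)
        also have "card (set (suffixes v) - {[]}) = length v"
          by (simp add: distinct_card)
        finally have "nat p \<le> nat q + length v"
          using least_period_eq_card[OF lp] least_period_eq_card[OF g.least_period_g] by simp
        then have le: "q \<le> int (length v)" using p_eq q_eq by simp
        \<comment> \<open>The letter after the second occurrence of \<open>v\<close> is moved back
          by the period \<open>q\<close> of \<open>h.g\<close>. As \<open>q \<le> length v\<close>,
          the new index is not negative, so \<open>h.g\<close> still agrees with \<open>f\<close>
          there, and the letter is the one after the first occurrence.\<close>
        have "f (c + q + int (length v)) = h.g (int (length v))"
          using h.g_eq[of "int (length v)"] h.q_pos by simp
        also have "\<dots> = h.g (int (length v) - q)"
          using h.g_period[of "int (length v) - q"] by (simp add: q_eq)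
        also have "\<dots> = f (c + int (length v))"
          using h.g_eq[of "int (length v) - q"] le g.q_pos by (simp add: q_eq)
        finally show False using differ by simp
      qed
      then have "card ?G + 1 \<le> n \<and> card ?H + 1 \<le> n - 1 \<or> card ?G + 1 \<le> n - 1 \<and> card ?H + 1 \<le> n"
        using small False n(2) by linarith
      then have "nat p \<le> F n + F (n - 1)"
        using IH p_eq F_mono[of "card ?G + 1" n] F_mono[of "card ?G + 1" "n - 1"]
          F_mono[of "card ?H + 1" n] F_mono[of "card ?H + 1" "n - 1"] by linarith
      then show ?thesis using F_rec[of n] n(2) by simp
    qed
  qed
qed

section \<open>Non-periodic words and the least period of their infinite power\<close>

lemma word_power_nth:
  assumes "i < m * length v"
  shows "word_power v m ! i = v ! (i mod length v)"
  using assms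
proof (induction m arbitrary: i)
  case (Suc m)
  then show ?case
    by (cases "i < length v") (auto simp: word_power_def nth_append le_mod_geq)
qed simp

lemma length_word_power: "length (word_power v m) = m * length v"
  by (induction m) (simp_all add: word_power_def)

text \<open>The least period \<open>d\<close> divides the length of \<open>u\<close>, so
  \<open>u\<close> is a power of its prefix of length \<open>d\<close>; non-periodicity leaves only
  exponent 1.\<close>

lemma least_period_biinfinite_power:
  assumes "u \<noteq> []" and "\<not> periodic_word u"
  shows "least_period (biinfinite_power u) (int (length u))"
proof -
  let ?W = "biinfinite_power u" and ?l = "int (length u)"
  have l: "0 < ?l" using assms(1) by simp
  have per: "?W (i + ?l) = ?W i" for i by (simp add: biinfinite_power_def)
  have nth: "?W (int i) = u ! i" if "i < length u" for i
    using that by (simp add: biinfinite_power_def)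
  \<comment> \<open>Periods are taken as natural numbers here so that a least one exists by
    well-ordering.\<close>
  define P where "P d \<longleftrightarrow> 0 < d \<and> (\<forall>i. ?W (i + int d) = ?W i)" for d
  define d where "d = (LEAST d. P d)"
  have "P (length u)" using l per by (simp add: P_def)
  then have Pd: "P d" unfolding d_def by (rule LeastI)
  have "d \<le> e" if "P e" for e using that unfolding d_def by (rule Least_le)
  then have "int d \<le> e" if "0 < e" "\<forall>i. ?W (i + e) = ?W i" for e
    using that by (metis P_def nat_0_le of_nat_0_less_iff order_less_imp_le zle_int)
  then have lp: "least_period ?W (int d)"
    using Pd by (auto simp: least_period_def P_def)
  have "int d dvd ?l" using least_period_dvd[OF lp per] .
  then obtain m where m: "length u = d * m" unfolding int_dvd_int_iff by (elim dvdE)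
  have "m = 1"
  proof (rule ccontr)
    assume "m \<noteq> 1"
    then have "2 \<le> m" using m assms(1) by (cases m) auto
    then have le: "d \<le> length u" using m by simp
    then have len: "length (take d u) = d" by simp
    have "u = word_power (take d u) m"
    proof (rule nth_equalityI)
      show "length u = length (word_power (take d u) m)"
        using len m by (simp add: length_word_power)
      fix i assume i: "i < length u"
      have d0: "0 < d" using Pd by (simp add: P_def)
      then have "i mod d < length u" using le by (meson mod_less_divisor order_less_le_trans)
      then have "u ! (i mod d) = ?W (int i mod int d)"
        using nth[of "i mod d"] by (simp add: zmod_int)
      also have "\<dots> = ?W (int i)"
        using Pd by (intro period_mod) (simp add: P_def)
      finally have "u ! i = u ! (i mod d)" using nth[OF i] by simp
      also have "\<dots> = take d u ! (i mod d)" using d0 by simp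
      finally show "u ! i = word_power (take d u) m ! i"
        using word_power_nth[of i m "take d u"] i len m by (simp add: mult.commute)
    qed
    then show False using assms \<open>2 \<le> m\<close> by (auto simp: periodic_word_def)
  qed
  then show ?thesis using lp m by simp
qed

theorem theorem2p10:
  fixes u :: "letter list" and W :: "int \<Rightarrow> letter" and n :: nat
  assumes "u \<noteq> []"
    and "\<not> periodic_word u"
    and "W = biinfinite_power u"
    and "finite {v. finite_fork v W}"
    and "card {v. finite_fork v W} = n"
  shows "length u \<le> F (n + 1)"
  using least_period_le_F[OF least_period_biinfinite_power[OF assms(1,2)], folded assms(3), OF assms(5)]
  by simp

end
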